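(* A probability measure $\mu$ on $(\Omega,\mathcal{F})$ is $\Lambda$-invariant if and only if it is order-invariant.
   Context: Notation: $\mathbb{N}=\{1,2,\dots\}$, $[k]=\{1,\dots,k\}$. Partial orders are strict. A suborder of $\mathbb{N}$ (or of $[k]$) is a partial order $<^{\mathbb{N}}$ on $\mathbb{N}$ (or $<^{[k]}$ on $[k]$) such that if $i$ is below $j$ in it then $i<j$ in the standard order. For a suborder $<^{\mathbb N}$, $<^{\mathbb N}_{[k]}$ denotes its restriction to $[k]$. The space: $\Omega$ is the set of pairs $\omega=(x_1x_2\cdots,<^{\mathbb{N}})$, where $x_1x_2\cdots$ is an infinite sequence of elements of $[0,1]$ and $<^{\mathbb{N}}$ is a suborder of $\mathbb{N}$. For Borel sets $B_1,\dots,B_k\subseteq[0,1]$ and a suborder $<^{[k]}$ of $[k]$, the basic event $E(B_1\cdots B_k,<^{[k]})$ is the set of $\omega=(x_1x_2\cdots,<^{\mathbb{N}})\in\Omega$ with $x_i\in B_i$ for $i=1,\dots,k$ and $<^{\mathbb{N}}_{[k]}$ equal to $<^{[k]}$. $\mathcal{F}$ is the $\sigma$-field on $\Omega$ generated by all basic events. Order-invariance: a linear extension of a suborder $<^{[k]}$ is a permutation $\lambda$ of $[k]$ such that $\lambda(i)<^{[k]}\lambda(j)$ implies $i<j$; $\lambda[<^{[k]}]$ is the suborder of $[k]$ in which $i$ is below $j$ if and only if $\lambda(i)<^{[k]}\lambda(j)$. A probability measure $\mu$ on $(\Omega,\mathcal{F})$ is order-invariant if $\mu(E(B_1\cdots B_k,<^{[k]}))=\mu(E(B_{\lambda(1)}\cdots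 B_{\lambda(k)},\lambda[<^{[k]}]))$ for all $k$, all Borel sets $B_1,\dots,B_k\subseteq[0,1]$, all suborders $<^{[k]}$ of $[k]$ and all linear extensions $\lambda$ of $<^{[k]}$. The maps $\lambda^{(i)}$: for $i\in\mathbb{N}$, $\lambda^{(i)}$ is the permutation of $\mathbb{N}$ exchanging $i$ and $i+1$ and fixing everything else. It acts on $\Omega$ as follows: for $\omega=(x_1x_2\cdots,<^{\mathbb N})$, if $i$ and $i+1$ are incomparable in $<^{\mathbb N}$ then $\lambda^{(i)}[\omega]=(x_{\lambda^{(i)}(1)}x_{\lambda^{(i)}(2)}\cdots,\lambda^{(i)}[<^{\mathbb N}])$, where $j$ is below $\ell$ in $\lambda^{(i)}[<^{\mathbb N}]$ iff $\lambda^{(i)}(j)<^{\mathbb N}\lambda^{(i)}(\ell)$; if $i<^{\mathbb N}i+1$ then $\lambda^{(i)}[\omega]=\omega$. This is a measurable involution of $\Omega$. Set $\lambda^{(i)}(E)=\{\lambda^{(i)}[\omega]:\omega\in E\}$ and $(\mu\circ\lambda^{(i)})(E)=\mu(\lambda^{(i)}(E))$ for $E\in\mathcal F$. $\mu$ is $\Lambda$-invariant if $\mu\circ\lambda^{(i)}=\mu$ for every $i\in\mathbb{N}$. *)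

theory Defs
  imports "HOL-Probability.Probability"
begin

text \<open>
  Index sets are \<open>{1..}\<close> and \<open>{1..k}\<close>, as subsets of type \<^typ>\<open>nat\<close>. Strict orders are sets of
  pairs contained in the square of the index set, and infinite sequences are extensional
  functions, so that points of \<open>\<Omega>\<close> and suborders of \<open>[k]\<close> carry no data off the index set.
\<close>

definition suborder :: "nat set \<Rightarrow> nat rel \<Rightarrow> bool" where
  "suborder A r \<longleftrightarrow> r \<subseteq> A \<times> A \<and> irrefl r \<and> trans r \<and> (\<forall>i j. (i, j) \<in> r \<longrightarrow> i < j)"

type_synonym point = "(nat \<Rightarrow> real) \<times> nat rel"

definition Omega :: "point set" where
  "Omega = ({1..} \<rightarrow>\<^sub>E {0..1}) \<times> {r. suborder {1..} r}"

definition basic_event :: "nat \<Rightarrow> (nat \<Rightarrow> real set) \<Rightarrow> nat rel \<Rightarrow> point set" where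
  "basic_event k B r =
     {(x, s). (x, s) \<in> Omega \<and> (\<forall>i\<in>{1..k}. x i \<in> B i) \<and> Restr s {1..k} = r}"

definition borel_family :: "nat \<Rightarrow> (nat \<Rightarrow> real set) \<Rightarrow> bool" where
  "borel_family k B \<longleftrightarrow> (\<forall>i\<in>{1..k}. B i \<in> sets borel \<and> B i \<subseteq> {0..1})"

definition event_algebra :: "point measure" where
  "event_algebra =
     sigma Omega {basic_event k B r | k B r. 1 \<le> k \<and> borel_family k B \<and> suborder {1..k} r}"

lemma space_event_algebra: "space event_algebra = Omega"
  and sets_event_algebra: "sets event_algebra =
    sigma_sets Omega {basic_event k B r | k B r. 1 \<le> k \<and> borel_family k B \<and> suborder {1..k} r}"
proof -
  have "{basic_event k B r | k B r. 1 \<le> k \<and> borel_family k B \<and> suborder {1..k} r} \<subseteq> Pow Omega"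
    by (auto simp: basic_event_def)
  then show "space event_algebra = Omega"
    and "sets event_algebra =
      sigma_sets Omega {basic_event k B r | k B r. 1 \<le> k \<and> borel_family k B \<and> suborder {1..k} r}"
    unfolding event_algebra_def by (simp_all add: space_measure_of_conv sets_measure_of)
qed

definition linear_extension :: "nat \<Rightarrow> nat rel \<Rightarrow> (nat \<Rightarrow> nat) \<Rightarrow> bool" where
  "linear_extension k r l \<longleftrightarrow> l permutes {1..k} \<and>
     (\<forall>i\<in>{1..k}. \<forall>j\<in>{1..k}. (l i, l j) \<in> r \<longrightarrow> i < j)"

text \<open>
  The relabelled order \<open>\<lambda>[<]\<close> is \<^term>\<open>inv_image r l\<close>, that is \<open>{(i, j). (l i, l j) \<in> r}\<close>: as
  \<open>l\<close> permutes the index set, this is again contained in the square of the index set.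
\<close>

definition order_invariant :: "point measure \<Rightarrow> bool" where
  "order_invariant \<mu> \<longleftrightarrow>
     (\<forall>k B r l. 1 \<le> k \<longrightarrow> borel_family k B \<longrightarrow> suborder {1..k} r \<longrightarrow> linear_extension k r l \<longrightarrow>
        emeasure \<mu> (basic_event k B r) = emeasure \<mu> (basic_event k (B \<circ> l) (inv_image r l)))"

text \<open>
  On \<open>\<Omega>\<close>, \<open>i\<close> and \<open>i + 1\<close> are comparable only by \<open>i\<close> being below \<open>i + 1\<close>.
\<close>

definition adj_swap :: "nat \<Rightarrow> point \<Rightarrow> point" where
  "adj_swap i = (\<lambda>(x, r). if (i, i + 1) \<in> r then (x, r)
     else (x \<circ> Transposition.transpose i (i + 1), inv_image r (Transposition.transpose i (i + 1))))"

lemma adj_swap_in_Omega: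
  assumes "1 \<le> i" "\<omega> \<in> Omega"
  shows "adj_swap i \<omega> \<in> Omega"
proof (cases \<omega>)
  case (Pair x r)
  let ?t = "Transposition.transpose i (i + 1)"
  have x: "x \<in> {1..} \<rightarrow>\<^sub>E {0..1}" and r: "suborder {1..} r"
    using assms(2) by (auto simp: Pair Omega_def)
  have t0: "1 \<le> ?t j \<longleftrightarrow> 1 \<le> j" for j
    using assms(1) by (auto simp: Transposition.transpose_def)
  have "suborder {1..} (inv_image r ?t)" if "(i, i + 1) \<notin> r"
    unfolding suborder_def
  proof (intro conjI allI impI)
    show "inv_image r ?t \<subseteq> {1..} \<times> {1..}"
      using r t0 by (fastforce simp: suborder_def inv_image_def)
    show "irrefl (inv_image r ?t)"
      using r by (auto simp: suborder_def irrefl_def)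
    show "trans (inv_image r ?t)"
      using r by (simp add: suborder_def trans_inv_image)
    fix a b assume "(a, b) \<in> inv_image r ?t"
    then have ab: "(?t a, ?t b) \<in> r" by simp
    then have "?t a < ?t b" using r by (auto simp: suborder_def)
    then show "a < b"
      using ab that by (auto simp: Transposition.transpose_def split: if_splits)
  qed
  moreover have "x \<circ> ?t \<in> {1..} \<rightarrow>\<^sub>E {0..1}"
    using x t0 by (fastforce simp: PiE_def Pi_def extensional_def)
  ultimately show ?thesis
    using assms(2) by (auto simp: Pair adj_swap_def Omega_def)
qed

lemma adj_swap_involution:
  assumes "\<omega> \<in> Omega"
  shows "adj_swap i (adj_swap i \<omega>) = \<omega>"
proof (cases \<omega>)
  case (Pair x r)
  have "(i + 1, i) \<notin> r"
    using assms by (fastforce simp: Pair Omega_def suborder_def)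
  then show ?thesis
    by (auto simp: Pair adj_swap_def inv_image_def fun_eq_iff)
qed

text \<open>
  The measure \<open>\<mu> \<circ> \<lambda>\<close> is evaluated on images, \<open>(\<mu> \<circ> \<lambda>)(E) = \<mu>(\<lambda>(E))\<close>; on \<open>\<Omega>\<close> images and preimages agree
  as the map is an involution.
\<close>

definition Lambda_invariant :: "point measure \<Rightarrow> bool" where
  "Lambda_invariant \<mu> \<longleftrightarrow>
     (\<forall>i\<ge>1. \<forall>E\<in>sets event_algebra. emeasure \<mu> (adj_swap i ` E) = emeasure \<mu> E)"

end

theory Submission
  imports Defs
begin

text \<open>
  Everything rests on one computation: if \<open>i\<close> and \<open>i + 1\<close> both lie in \<open>[k]\<close> and are incomparable in
  a suborder \<open>r\<close> of \<open>[k]\<close>, then \<^term>\<open>adj_swap i\<close> carries the basic event of \<open>(B, r)\<close> onto the basic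
  event of \<open>B\<close> and \<open>r\<close> relabelled by the transposition \<open>(i, i + 1)\<close>
  (\<open>adj_swap_image_incomparable\<close>). This transposition is a linear extension of \<open>r\<close>, so each kind of
  invariance speaks about the same pair of events.

  From \<open>\<Lambda>\<close>-invariance to order-invariance, a linear extension is sorted into the identity by
  exchanging adjacent entries that are out of order. Two such entries are labels of elements that
  are incomparable in \<open>r\<close>, so every intermediate permutation is again a linear extension, and
  each exchange is an application of some \<^term>\<open>adj_swap i\<close>, which preserves the measure.

  From order-invariance to \<open>\<Lambda>\<close>-invariance, \<open>\<mu>\<close> and its image under \<^term>\<open>adj_swap i\<close> have to be
  compared on the whole \<open>\<sigma>\<close>-field. They agree on the basic events of length at least \<open>i + 1\<close>: such
  an event is fixed pointwise if \<open>(i, i + 1) \<in> r\<close>, and is otherwise covered by the computation above.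
  Shorter basic events do not record whether \<open>i\<close> and \<open>i + 1\<close> are comparable, but they are
  finite unions of long ones. Hence the long basic events form an intersection-stable generator
  (\<open>Int_stable_long_events\<close>, \<open>sets_event_algebra_long_events\<close>), and two finite measures that
  agree on it are equal.
\<close>

section \<open>Relabelling suborders\<close>

abbreviation adj_transpose :: "nat \<Rightarrow> nat \<Rightarrow> nat" where
  "adj_transpose i \<equiv> Transposition.transpose i (i + 1)"

lemma suborderD: "suborder A r \<Longrightarrow> (i, j) \<in> r \<Longrightarrow> i \<in> A \<and> j \<in> A \<and> i < j"
  by (auto simp: suborder_def)

lemma suborder_Restr:
  assumes "suborder A r" "C \<subseteq> A"
  shows "suborder C (Restr r C)"
proof -
  have "trans (Restr r C)"
    using assms(1) by (auto simp: suborder_def intro!: transI dest: transD)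
  then show ?thesis
    using assms by (auto simp: suborder_def irrefl_def)
qed

lemma suborder_linear_extension:
  assumes r: "suborder {1..k} r" and l: "linear_extension k r l"
  shows "suborder {1..k} (inv_image r l)"
proof -
  have p: "l permutes {1..k}"
    using l by (simp add: linear_extension_def)
  have mem: "i \<in> {1..k} \<and> j \<in> {1..k}" if "(l i, l j) \<in> r" for i j
    using suborderD[OF r that] permutes_in_image[OF p] by blast
  have "inv_image r l \<subseteq> {1..k} \<times> {1..k}"
    using mem by fastforce
  moreover have "i < j" if "(i, j) \<in> inv_image r l" for i j
    using that mem l by (auto simp: linear_extension_def)
  moreover have "irrefl (inv_image r l)" "trans (inv_image r l)"
    using r by (auto simp: suborder_def irrefl_def intro: trans_inv_image)
  ultimately show ?thesis
    by (auto simp: suborder_def)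
qed

lemma borel_family_permutes:
  assumes "borel_family k B" "l permutes {1..k}"
  shows "borel_family k (B \<circ> l)"
  using assms(1) permutes_in_image[OF assms(2)] by (simp add: borel_family_def del: atLeastAtMost_iff)

lemma adj_transpose_permutes:
  assumes "1 \<le> i" "i + 1 \<le> k"
  shows "adj_transpose i permutes {1..k}"
  using assms by (intro permutes_swap_id) auto

text \<open>
  An adjacent transposition reverses the order of no two numbers other than \<open>i\<close> and \<open>i + 1\<close>, so it
  keeps a linear extension one unless the extension puts a comparable pair there.
\<close>

lemma linear_extension_comp_adj_transpose:
  assumes l: "linear_extension k r l" and i: "1 \<le> i" "i + 1 \<le> k" and nr: "(l i, l (i + 1)) \<notin> r"
  shows "linear_extension k r (l \<circ> adj_transpose i)"
  unfolding linear_extension_def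
proof (intro conjI ballI impI)
  let ?t = "adj_transpose i"
  have t: "?t permutes {1..k}"
    using i by (rule adj_transpose_permutes)
  show "l \<circ> ?t permutes {1..k}"
    using l t by (auto simp: linear_extension_def intro: permutes_compose)
  fix a b assume ab: "a \<in> {1..k}" "b \<in> {1..k}" "((l \<circ> ?t) a, (l \<circ> ?t) b) \<in> r"
  have "?t a \<in> {1..k}" "?t b \<in> {1..k}"
    using ab permutes_in_image[OF t] by auto
  then have "?t a < ?t b"
    using l ab by (auto simp: linear_extension_def)
  moreover have "\<not> (a = i + 1 \<and> b = i)"
    using ab(3) nr by auto
  ultimately show "a < b"
    by (auto simp: Transposition.transpose_def split: if_splits)
qed

lemma linear_extension_id: "suborder {1..k} r \<Longrightarrow> linear_extension k r id"
  by (auto simp: linear_extension_def permutes_id dest: suborderD)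

lemma linear_extension_adj_transpose:
  assumes "suborder {1..k} r" "1 \<le> i" "i + 1 \<le> k" "(i, i + 1) \<notin> r"
  shows "linear_extension k r (adj_transpose i)"
  using linear_extension_comp_adj_transpose[OF linear_extension_id[OF assms(1)]] assms by simp

section \<open>Adjacent exchanges of basic events\<close>

lemma adj_swap_basic_event_subset:
  assumes i: "1 \<le> i" "i + 1 \<le> k" and nr: "(i, i + 1) \<notin> r"
  shows "adj_swap i ` basic_event k B r
    \<subseteq> basic_event k (B \<circ> adj_transpose i) (inv_image r (adj_transpose i))"
proof
  let ?t = "adj_transpose i"
  have t: "?t a \<in> {1..k} \<longleftrightarrow> a \<in> {1..k}" for a
    using permutes_in_image[OF adj_transpose_permutes[OF i]] .
  fix \<omega> assume "\<omega> \<in> adj_swap i ` basic_event k B r"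
  then obtain x s where xs: "(x, s) \<in> Omega" "\<forall>j\<in>{1..k}. x j \<in> B j" "Restr s {1..k} = r"
      and \<omega>: "\<omega> = adj_swap i (x, s)"
    by (auto simp: basic_event_def)
  have "(i, i + 1) \<notin> s"
    using xs(3) nr i by auto
  then have eq: "\<omega> = (x \<circ> ?t, inv_image s ?t)"
    by (simp add: \<omega> adj_swap_def)
  have "Restr (inv_image s ?t) {1..k} = inv_image (Restr s {1..k}) ?t"
    unfolding inv_image_def using t by blast
  moreover have "\<forall>j\<in>{1..k}. (x \<circ> ?t) j \<in> (B \<circ> ?t) j"
    using xs(2) t by auto
  moreover have "\<omega> \<in> Omega"
    using adj_swap_in_Omega[OF i(1) xs(1)] by (simp add: \<omega>)
  ultimately show "\<omega> \<in> basic_event k (B \<circ> ?t) (inv_image r ?t)"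
    using xs(3) by (simp add: eq basic_event_def)
qed

text \<open>
  The exchanged event satisfies the same hypotheses and is exchanged back into the original one,
  so the inclusion just proved, used twice, gives equality by the involution property.
\<close>

lemma adj_swap_image_incomparable:
  assumes r: "suborder {1..k} r" and i: "1 \<le> i" "i + 1 \<le> k" and nr: "(i, i + 1) \<notin> r"
  shows "adj_swap i ` basic_event k B r
    = basic_event k (B \<circ> adj_transpose i) (inv_image r (adj_transpose i))"
proof (rule antisym)
  let ?t = "adj_transpose i"
  let ?E = "basic_event k (B \<circ> ?t) (inv_image r ?t)"
  show "adj_swap i ` basic_event k B r \<subseteq> ?E"
    using i nr by (rule adj_swap_basic_event_subset)
  have "(i, i + 1) \<notin> inv_image r ?t"
    using suborderD[OF r, of "i + 1" i] by auto
  from adj_swap_basic_event_subset[OF i this]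
  have "adj_swap i ` ?E \<subseteq> basic_event k (B \<circ> ?t \<circ> ?t) (inv_image (inv_image r ?t) ?t)" .
  also have "B \<circ> ?t \<circ> ?t = B"
    by (simp add: fun_eq_iff)
  also have "inv_image (inv_image r ?t) ?t = r"
    by (simp add: inv_image_def)
  finally have returns: "adj_swap i ` ?E \<subseteq> basic_event k B r" .
  show "?E \<subseteq> adj_swap i ` basic_event k B r"
  proof
    fix \<omega> assume \<omega>: "\<omega> \<in> ?E"
    then have "adj_swap i (adj_swap i \<omega>) = \<omega>"
      by (intro adj_swap_involution) (auto simp: basic_event_def)
    then show "\<omega> \<in> adj_swap i ` basic_event k B r"
      using returns \<omega> by (metis image_eqI image_subset_iff)
  qed
qed

lemma adj_swap_image_comparable:
  assumes "(i, i + 1) \<in> r"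
  shows "adj_swap i ` basic_event k B r = basic_event k B r"
proof -
  have "adj_swap i \<omega> = \<omega>" if "\<omega> \<in> basic_event k B r" for \<omega>
    using that assms by (auto simp: basic_event_def adj_swap_def)
  then show ?thesis by simp
qed

lemma adj_swap_vimage:
  assumes "1 \<le> i" "E \<subseteq> Omega"
  shows "adj_swap i -` E \<inter> Omega = adj_swap i ` E"
proof (intro set_eqI iffI)
  fix \<omega> assume "\<omega> \<in> adj_swap i -` E \<inter> Omega"
  then show "\<omega> \<in> adj_swap i ` E"
    by (metis IntE adj_swap_involution image_eqI vimageE)
next
  fix \<omega> assume "\<omega> \<in> adj_swap i ` E"
  then obtain \<eta> where \<eta>: "\<eta> \<in> E" "\<omega> = adj_swap i \<eta>" by blast
  then have "\<eta> \<in> Omega" using assms(2) by blast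
  then show "\<omega> \<in> adj_swap i -` E \<inter> Omega"
    using \<eta> assms(1) by (simp add: adj_swap_involution adj_swap_in_Omega)
qed

section \<open>Long basic events as a generator\<close>

definition long_events :: "nat \<Rightarrow> point set set" where
  "long_events n =
     {basic_event k B r | k B r. 1 \<le> k \<and> n \<le> k \<and> borel_family k B \<and> suborder {1..k} r}"

lemma long_eventsI:
  "1 \<le> k \<Longrightarrow> n \<le> k \<Longrightarrow> borel_family k B \<Longrightarrow> suborder {1..k} r \<Longrightarrow> basic_event k B r \<in> long_events n"
  by (auto simp: long_events_def)

lemma long_eventsE:
  assumes "E \<in> long_events n"
  obtains k B r where "1 \<le> k" "n \<le> k" "borel_family k B" "suborder {1..k} r"
    "E = basic_event k B r"
  using assms by (auto simp: long_events_def)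

lemma long_events_subset_Pow: "long_events n \<subseteq> Pow Omega"
  by (auto simp: long_events_def basic_event_def)

lemma sets_event_algebra_long_events_0: "sets event_algebra = sigma_sets Omega (long_events 0)"
  by (simp add: sets_event_algebra long_events_def)

lemma basic_event_iff:
  "\<omega> \<in> basic_event k B r \<longleftrightarrow>
    \<omega> \<in> Omega \<and> (\<forall>i\<in>{1..k}. fst \<omega> i \<in> B i) \<and> Restr (snd \<omega>) {1..k} = r"
  by (cases \<omega>) (simp add: basic_event_def)

lemma Restr_Restr_atLeastAtMost:
  fixes k k' :: nat
  assumes "k \<le> k'"
  shows "Restr (Restr s {1..k'}) {1..k} = Restr s {1..k}"
proof -
  have "{1..k} \<subseteq> {1..k'}" using assms by auto
  then show ?thesis by blast
qed

lemma basic_event_Int: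
  assumes "k \<le> k'" "Restr r' {1..k} = r"
  shows "basic_event k B r \<inter> basic_event k' B' r'
    = basic_event k' (\<lambda>i. if i \<le> k then B i \<inter> B' i else B' i) r'"
proof (rule set_eqI)
  fix \<omega> :: point
  have "(\<forall>i\<in>{1..k}. fst \<omega> i \<in> B i) \<and> (\<forall>i\<in>{1..k'}. fst \<omega> i \<in> B' i)
      \<longleftrightarrow> (\<forall>i\<in>{1..k'}. fst \<omega> i \<in> (if i \<le> k then B i \<inter> B' i else B' i))"
    using assms(1) by auto
  moreover have "Restr (snd \<omega>) {1..k'} = r' \<longrightarrow> Restr (snd \<omega>) {1..k} = r"
    using Restr_Restr_atLeastAtMost[OF assms(1), of "snd \<omega>"] assms(2) by metis
  ultimately show "\<omega> \<in> basic_event k B r \<inter> basic_event k' B' r'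
      \<longleftrightarrow> \<omega> \<in> basic_event k' (\<lambda>i. if i \<le> k then B i \<inter> B' i else B' i) r'"
    unfolding basic_event_iff Int_iff by argo
qed

lemma basic_event_Int_empty:
  assumes "k \<le> k'" "Restr r' {1..k} \<noteq> r"
  shows "basic_event k B r \<inter> basic_event k' B' r' = {}"
proof (rule equals0I)
  fix \<omega> assume "\<omega> \<in> basic_event k B r \<inter> basic_event k' B' r'"
  then have "Restr (snd \<omega>) {1..k} = r" "Restr (snd \<omega>) {1..k'} = r'"
    unfolding basic_event_iff Int_iff by argo+
  then show False
    using Restr_Restr_atLeastAtMost[OF assms(1), of "snd \<omega>"] assms(2) by metis
qed

lemma empty_in_long_events: "{} \<in> long_events n"
proof -
  have "basic_event (Suc n) (\<lambda>_. {}) {} = {}"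
    by (auto simp: basic_event_def)
  moreover have "basic_event (Suc n) (\<lambda>_. {}) {} \<in> long_events n"
    by (intro long_eventsI) (auto simp: borel_family_def suborder_def irrefl_def)
  ultimately show ?thesis by simp
qed

text \<open>
  The longer of two basic events decides the order on the shorter prefix, so the two events are
  either disjoint or meet in a basic event of the greater length.
\<close>

lemma Int_stable_long_events: "Int_stable (long_events n)"
proof (rule Int_stableI)
  have *: "basic_event k B r \<inter> basic_event k' B' r' \<in> long_events n"
    if "k \<le> k'" "1 \<le> k'" "n \<le> k'" "borel_family k B" "borel_family k' B'" "suborder {1..k'} r'"
    for k k' B B' r r'
  proof (cases "Restr r' {1..k} = r")
    case True
    then show ?thesis
      unfolding basic_event_Int[OF that(1) True] using that
      by (intro long_eventsI) (auto simp: borel_family_def)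
  next
    case False
    then show ?thesis
      using basic_event_Int_empty[OF that(1) False] empty_in_long_events by simp
  qed
  fix E F assume "E \<in> long_events n" "F \<in> long_events n"
  then obtain k B r k' B' r' where
    E: "1 \<le> k" "n \<le> k" "borel_family k B" "suborder {1..k} r" "E = basic_event k B r" and
    F: "1 \<le> k'" "n \<le> k'" "borel_family k' B'" "suborder {1..k'} r'" "F = basic_event k' B' r'"
    by (elim long_eventsE) blast
  show "E \<inter> F \<in> long_events n"
  proof (cases "k \<le> k'")
    case True
    show ?thesis
      unfolding E(5) F(5) by (intro * True E F)
  next
    case False
    then have "k' \<le> k" by simp
    then show ?thesis
      unfolding E(5) F(5) by (subst Int_commute) (intro * E F)
  qed
qed

text \<open>
  Finiteness of the union below is what brings short basic events into the \<open>\<sigma>\<close>-field generated by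
  long ones.
\<close>

lemma basic_event_refine:
  assumes "k \<le> K"
  shows "basic_event k B r = (\<Union>r'\<in>{r'. suborder {1..K} r' \<and> Restr r' {1..k} = r}.
    basic_event K (\<lambda>i. if i \<le> k then B i else {0..1}) r')" (is "?L = ?R")
proof (intro set_eqI iffI)
  fix \<omega> assume "\<omega> \<in> ?L"
  then have \<omega>: "\<omega> \<in> Omega" and B: "\<forall>j\<in>{1..k}. fst \<omega> j \<in> B j" and r: "Restr (snd \<omega>) {1..k} = r"
    unfolding basic_event_iff by blast+
  let ?r' = "Restr (snd \<omega>) {1..K}"
  have "suborder {1..K} ?r'"
    using \<omega> by (intro suborder_Restr[of "{1..}"]) (auto simp: Omega_def)
  moreover have "Restr ?r' {1..k} = r"
    unfolding Restr_Restr_atLeastAtMost[OF assms] by (rule r)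
  moreover have "\<forall>j\<in>{1..K}. fst \<omega> j \<in> (if j \<le> k then B j else {0..1})"
  proof
    fix j assume j: "j \<in> {1..K}"
    have "fst \<omega> \<in> {1..} \<rightarrow>\<^sub>E {0..1}"
      using \<omega> unfolding Omega_def mem_Times_iff by (rule conjunct1)
    then have "fst \<omega> j \<in> {0..1}"
      by (rule PiE_mem) (use j in simp)
    then show "fst \<omega> j \<in> (if j \<le> k then B j else {0..1})"
      using B j by simp
  qed
  then have "\<omega> \<in> basic_event K (\<lambda>i. if i \<le> k then B i else {0..1}) ?r'"
    unfolding basic_event_iff using \<omega> by blast
  ultimately show "\<omega> \<in> ?R" by blast
next
  fix \<omega> assume "\<omega> \<in> ?R"
  then obtain r' where r': "Restr r' {1..k} = r"
    and "\<omega> \<in> basic_event K (\<lambda>i. if i \<le> k then B i else {0..1}) r'" by blast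
  then have \<omega>: "\<omega> \<in> Omega" and B: "\<forall>j\<in>{1..K}. fst \<omega> j \<in> (if j \<le> k then B j else {0..1})"
    and K: "Restr (snd \<omega>) {1..K} = r'"
    unfolding basic_event_iff by blast+
  have "Restr (snd \<omega>) {1..k} = r"
    using Restr_Restr_atLeastAtMost[OF assms, of "snd \<omega>"] unfolding K r' by (rule sym)
  moreover have "fst \<omega> j \<in> B j" if "j \<in> {1..k}" for j
    using bspec[OF B, of j] that assms by simp
  ultimately show "\<omega> \<in> ?L"
    unfolding basic_event_iff using \<omega> by blast
qed

lemma finite_suborders: "finite {r. suborder {1..K} r \<and> P r}"
  by (rule finite_subset[of _ "Pow ({1..K} \<times> {1..K})"]) (auto simp: suborder_def)

lemma sets_event_algebra_long_events:
  "sets event_algebra = sigma_sets Omega (long_events n)"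
proof -
  have "E \<in> sigma_sets Omega (long_events n)" if "E \<in> long_events 0" for E
    using that
  proof (cases rule: long_eventsE)
    case (1 k B r)
    define K where "K = max k n"
    have K: "k \<le> K" "n \<le> K" "1 \<le> K" using 1 by (auto simp: K_def)
    interpret sigma_algebra Omega "sigma_sets Omega (long_events n)"
      by (rule sigma_algebra_sigma_sets[OF long_events_subset_Pow])
    have "borel_family K (\<lambda>i. if i \<le> k then B i else {0..1})"
      using 1 by (auto simp: borel_family_def)
    then show ?thesis
      unfolding 1(5) basic_event_refine[OF K(1)] using K
      by (intro finite_UN finite_suborders) (auto intro!: sigma_sets.Basic long_eventsI)
  qed
  moreover have "long_events n \<subseteq> long_events 0"
    by (auto simp: long_events_def)
  ultimately show ?thesis
    unfolding sets_event_algebra_long_events_0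
    by (intro antisym sigma_sets_mono sigma_sets_mono') auto
qed

lemma Omega_eq_Union_long_events:
  assumes "1 \<le> n"
  obtains A where "A \<subseteq> long_events n" "finite A" "\<Union>A = Omega"
proof
  let ?A = "basic_event n (\<lambda>i. if i \<le> 0 then {} else {0..1}) `
    {r'. suborder {1..n} r' \<and> Restr r' {1..0} = {}}"
  show "?A \<subseteq> long_events n"
    using assms by (auto intro!: long_eventsI simp: borel_family_def)
  show "finite ?A"
    by (intro finite_imageI finite_suborders)
  (* The event of length 0 imposes no condition, so refining it covers the whole space. *)
  have "Omega = basic_event 0 (\<lambda>_. {}) {}"
    by (auto simp: basic_event_def)
  also have "\<dots> = \<Union>?A"
    by (rule basic_event_refine) simp
  finally show "\<Union>?A = Omega" ..
qed

section \<open>From order-invariance to invariance under adjacent exchanges\<close>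

lemma adj_swap_long_events:
  assumes i: "1 \<le> i" and E: "E \<in> long_events (i + 1)"
  shows "adj_swap i ` E \<in> long_events (i + 1)"
  using E
proof (cases rule: long_eventsE)
  case (1 k B r)
  show ?thesis
  proof (cases "(i, i + 1) \<in> r")
    case True
    then show ?thesis
      using E adj_swap_image_comparable[OF True] by (simp add: 1(5))
  next
    case False
    show ?thesis
      unfolding 1(5) adj_swap_image_incomparable[OF 1(4) i 1(2) False]
      by (intro long_eventsI 1 borel_family_permutes adj_transpose_permutes i
          suborder_linear_extension linear_extension_adj_transpose False)
  qed
qed

lemma measurable_adj_swap:
  assumes "1 \<le> i"
  shows "adj_swap i \<in> measurable event_algebra event_algebra"
proof (rule measurable_sigma_sets[OF sets_event_algebra_long_events long_events_subset_Pow])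
  show "adj_swap i \<in> space event_algebra \<rightarrow> Omega"
    using adj_swap_in_Omega[OF assms] by (auto simp: space_event_algebra)
  fix E assume E: "E \<in> long_events (i + 1)"
  then have "adj_swap i -` E \<inter> space event_algebra = adj_swap i ` E"
    using long_events_subset_Pow by (subst space_event_algebra, intro adj_swap_vimage assms) blast
  also have "\<dots> \<in> sets event_algebra"
    using adj_swap_long_events[OF assms E]
    by (simp add: sets_event_algebra_long_events[of "i + 1"] sigma_sets.Basic)
  finally show "adj_swap i -` E \<inter> space event_algebra \<in> sets event_algebra" .
qed

lemma order_invariant_adj_swap_long_events:
  assumes \<mu>: "order_invariant \<mu>" and i: "1 \<le> i" and E: "E \<in> long_events (i + 1)"
  shows "emeasure \<mu> (adj_swap i ` E) = emeasure \<mu> E"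
  using E
proof (cases rule: long_eventsE)
  case (1 k B r)
  show ?thesis
  proof (cases "(i, i + 1) \<in> r")
    case True
    then show ?thesis
      by (simp add: 1(5) adj_swap_image_comparable[OF True])
  next
    case False
    have "linear_extension k r (adj_transpose i)"
      using 1 i False by (intro linear_extension_adj_transpose)
    then have "emeasure \<mu> (basic_event k B r) =
        emeasure \<mu> (basic_event k (B \<circ> adj_transpose i) (inv_image r (adj_transpose i)))"
      using \<mu> 1 unfolding order_invariant_def by blast
    then show ?thesis
      unfolding 1(5) adj_swap_image_incomparable[OF 1(4) i 1(2) False] by simp
  qed
qed

lemma order_invariant_imp_Lambda_invariant:
  assumes "finite_measure \<mu>" and sets_\<mu>: "sets \<mu> = sets event_algebra" and inv: "order_invariant \<mu>"
  shows "Lambda_invariant \<mu>"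
  unfolding Lambda_invariant_def
proof (intro allI impI ballI)
  interpret finite_measure \<mu> by fact
  fix i :: nat and E assume i: "1 \<le> i" and E: "E \<in> sets event_algebra"
  have space_\<mu>: "space \<mu> = Omega"
    using sets_eq_imp_space_eq[OF sets_\<mu>] by (simp add: space_event_algebra)
  have meas: "adj_swap i \<in> measurable \<mu> event_algebra"
    using measurable_adj_swap[OF i] measurable_cong_sets[OF sets_\<mu> refl] by blast
  define \<nu> where "\<nu> = distr \<mu> event_algebra (adj_swap i)"
  have \<nu>: "emeasure \<nu> F = emeasure \<mu> (adj_swap i ` F)" if "F \<in> sets event_algebra" for F
  proof -
    have "F \<subseteq> Omega"
      using sets.sets_into_space[OF that] by (simp add: space_event_algebra)
    then show ?thesis
      using that meas adj_swap_vimage[OF i] by (simp add: \<nu>_def emeasure_distr space_\<mu>)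
  qed
  obtain A where A: "A \<subseteq> long_events (i + 1)" "finite A" "\<Union>A = Omega"
    using Omega_eq_Union_long_events[of "i + 1"] by auto
  have "\<mu> = \<nu>"
  proof (rule measure_eqI_generator_eq_countable
      [OF Int_stable_long_events long_events_subset_Pow])
    fix F assume F: "F \<in> long_events (i + 1)"
    then have "F \<in> sets event_algebra"
      by (simp add: sets_event_algebra_long_events[of "i + 1"] sigma_sets.Basic)
    then show "emeasure \<mu> F = emeasure \<nu> F"
      using order_invariant_adj_swap_long_events[OF inv i F] by (simp add: \<nu>)
  qed (use A sets_\<mu> in \<open>auto simp: \<nu>_def sets_event_algebra_long_events[of "i + 1"]
      intro: countable_finite\<close>)
  then show "emeasure \<mu> (adj_swap i ` E) = emeasure \<mu> E"
    using \<nu>[OF E] by simp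
qed

section \<open>Sorting a linear extension\<close>

lemma permutes_no_descent_imp_id:
  fixes l :: "nat \<Rightarrow> nat"
  assumes l: "l permutes {1..k}" and asc: "\<And>i. 1 \<le> i \<Longrightarrow> i + 1 \<le> k \<Longrightarrow> l i \<le> l (i + 1)"
  shows "l = id"
proof (rule permutes_natset_ge[OF l], rule ballI)
  fix j assume "j \<in> {1..k}"
  then have "1 \<le> j" "j \<le> k" by auto
  then show "j \<le> l j"
  proof (induction j rule: dec_induct)
    case base
    then show ?case using permutes_in_image[OF l, of 1] by simp
  next
    case (step j)
    have "l j \<noteq> l (Suc j)"
      using permutes_inj[OF l] by (metis injD n_not_Suc_n)
    then show ?case
      using step asc[of j] by simp
  qed
qed

text \<open>
  The rearrangement inequality on two adjacent places: with decreasing weights \<open>k - j\<close>, removing a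
  descent lowers the weighted sum. This is the termination measure for sorting.
\<close>

lemma weighted_sum_adj_transpose_less:
  fixes l :: "nat \<Rightarrow> nat"
  assumes i: "1 \<le> i" "i + 1 \<le> k" and desc: "l (i + 1) < l i"
  shows "(\<Sum>j\<in>{1..k}. (k - j) * (l \<circ> adj_transpose i) j) < (\<Sum>j\<in>{1..k}. (k - j) * l j)"
proof -
  let ?t = "adj_transpose i"
  let ?S = "{1..k} - {i, i + 1}"
  have split: "(\<Sum>j\<in>{1..k}. f j) = f i + f (i + 1) + (\<Sum>j\<in>?S. f j)" for f :: "nat \<Rightarrow> nat"
  proof -
    have "(\<Sum>j\<in>{1..k}. f j) = (\<Sum>j\<in>?S. f j) + (\<Sum>j\<in>{i, i + 1}. f j)"
      using i by (intro sum.subset_diff) auto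
    then show ?thesis by simp
  qed
  have rest: "(\<Sum>j\<in>?S. (k - j) * (l \<circ> ?t) j) = (\<Sum>j\<in>?S. (k - j) * l j)"
    by (intro sum.cong) (auto simp: Transposition.transpose_def)
  obtain d where d: "k - i = Suc d" "k - (i + 1) = d"
    using i by (metis Suc_diff_Suc Suc_eq_plus1 less_eq_Suc_le)
  show ?thesis
    unfolding split rest using desc by (simp add: d del: One_nat_def)
qed

text \<open>
  If \<open>l i\<close> and \<open>l (i + 1)\<close> form a descent of the linear extension \<open>l\<close>, they are incomparable in
  \<open>r\<close>: \<open>l i\<close> is not below \<open>l (i + 1)\<close>, because \<open>r\<close> is contained in the standard order, and
  \<open>l (i + 1)\<close> is not below \<open>l i\<close>, because \<open>l\<close> is a linear extension. So the descent can be removed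
  by \<^term>\<open>adj_swap i\<close>, which preserves the measure, and a permutation without descents is the
  identity.
\<close>

lemma Lambda_invariant_linear_extension:
  assumes inv: "Lambda_invariant \<mu>" and k: "1 \<le> k" and B: "borel_family k B"
    and r: "suborder {1..k} r" and l: "linear_extension k r l"
  shows "emeasure \<mu> (basic_event k (B \<circ> l) (inv_image r l)) = emeasure \<mu> (basic_event k B r)"
  using l
proof (induction "\<Sum>j\<in>{1..k}. (k - j) * l j" arbitrary: l rule: less_induct)
  case less
  have p: "l permutes {1..k}"
    using less.prems by (simp add: linear_extension_def)
  show ?case
  proof (cases "\<exists>i\<ge>1. i + 1 \<le> k \<and> l (i + 1) < l i")
    case False
    then have "l = id"
      using permutes_no_descent_imp_id[OF p] by (meson not_less)
    then show ?thesis by (simp add: inv_image_def)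
  next
    case True
    then obtain i where i: "1 \<le> i" "i + 1 \<le> k" and desc: "l (i + 1) < l i" by blast
    let ?t = "adj_transpose i"
    let ?E = "basic_event k (B \<circ> l) (inv_image r l)"
    have nr: "(l i, l (i + 1)) \<notin> r"
      using suborderD[OF r] desc by fastforce
    have sub: "suborder {1..k} (inv_image r l)"
      using r less.prems by (rule suborder_linear_extension)
    have "?E \<in> long_events 0"
      using k sub borel_family_permutes[OF B p] by (intro long_eventsI) auto
    then have "?E \<in> sets event_algebra"
      by (simp add: sets_event_algebra_long_events_0 sigma_sets.Basic)
    then have "emeasure \<mu> ?E = emeasure \<mu> (adj_swap i ` ?E)"
      using inv i(1) by (simp add: Lambda_invariant_def)
    also have "adj_swap i ` ?E = basic_event k (B \<circ> l \<circ> ?t) (inv_image (inv_image r l) ?t)"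
      using nr by (intro adj_swap_image_incomparable sub i) simp
    also have "\<dots> = basic_event k (B \<circ> (l \<circ> ?t)) (inv_image r (l \<circ> ?t))"
      by (simp add: comp_assoc inv_image_def)
    also have "emeasure \<mu> \<dots> = emeasure \<mu> (basic_event k B r)"
      using weighted_sum_adj_transpose_less[OF i desc]
        linear_extension_comp_adj_transpose[OF less.prems i nr]
      by (rule less.hyps)
    finally show ?thesis .
  qed
qed

theorem theorem6p2:
  fixes \<mu> :: "point measure"
  assumes "prob_space \<mu>" and "sets \<mu> = sets event_algebra"
  shows "Lambda_invariant \<mu> \<longleftrightarrow> order_invariant \<mu>"
proof
  assume "Lambda_invariant \<mu>"
  then show "order_invariant \<mu>"
    unfolding order_invariant_def by (auto dest: Lambda_invariant_linear_extension)
next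
  assume "order_invariant \<mu>"
  then show "Lambda_invariant \<mu>"
    using assms order_invariant_imp_Lambda_invariant prob_space.finite_measure by blast
qed

end
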